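(* Let $t\ge1$, $s>0$, and let $R_{N(1)}(t)=\sum_{j=1}^{N(1)}\mu(t-V_j)$ be the random sum described in the context, with bivariate Laplace transform $\phi_{R_{N(1)}(t),R_{N(1)}(t+s)}(y,z)=E[\mathrm{e}^{-yR_{N(1)}(t)-zR_{N(1)}(t+s)}]$. For $j=0,1,2$ let $$\psi_j(y)=\int_0^1(-\mu(t+s-v))^j\,\mathrm{e}^{-\mu(t-v)y}\,\Lambda(\mathrm{d}v).$$ Let $\ell=1,2,\ldots$ and $j=0,1,2$; let $\phi^{(\ell,j)}_{R_{N(1)}(t),R_{N(1)}(t+s)}(1,0)$ be the $(\ell,j)$-th partial derivative of $\phi_{R_{N(1)}(t),R_{N(1)}(t+s)}(y,z)$ at $(y,z)=(1,0)$ and let $\psi_j^{(\ell)}(1)$ be the $\ell$-th derivative of $\psi_j(y)$ at $y=1$. Then $$\psi_j^{(\ell)}(1)=\int_0^1(-\mu(t+s-v))^j(-\mu(t-v))^\ell\,\mathrm{e}^{-\mu(t-v)}\,\Lambda(\mathrm{d}v),\quad j=0,1,2,$$ and $$\phi^{(\ell,0)}_{R_{N(1)}(t),R_{N(1)}(t+s)}(1,0)=\sum_{k=0}^{\ell-1}\binom{\ell-1}{k}\phi^{(k,0)}_{R_{N(1)}(t),R_{N(1)}(t+s)}(1,0)\,\psi_0^{(\ell-k)}(1),$$ $$\phi^{(\ell,1)}_{R_{N(1)}(t),R_{N(1)}(t+s)}(1,0)=\sum_{k=0}^{\ell}\binom{\ell}{k}\phi^{(k,0)}_{R_{N(1)}(t),R_{N(1)}(t+s)}(1,0)\,\psi_1^{(\ell-k)}(1),$$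 $$\phi^{(\ell,2)}_{R_{N(1)}(t),R_{N(1)}(t+s)}(1,0)=\sum_{k=0}^{\ell}\binom{\ell}{k}\phi^{(k,1)}_{R_{N(1)}(t),R_{N(1)}(t+s)}(1,0)\,\psi_1^{(\ell-k)}(1)+\sum_{k=0}^{\ell}\binom{\ell}{k}\phi^{(k,0)}_{R_{N(1)}(t),R_{N(1)}(t+s)}(1,0)\,\psi_2^{(\ell-k)}(1).$$
   Context: $N$ is a non-homogeneous Poisson process on $[0,\infty)$ with locally finite mean measure $\Lambda$ and $\Lambda(1):=\Lambda[0,1]\in(0,\infty)$, so $N(1)$ is Poisson with mean $\Lambda(1)$. The function $\mu:[0,\infty)\to[0,\infty)$ is nondecreasing and continuous with $\mu(0)=0$ and $\lim_{t\to\infty}\mu(t)<\infty$ (it is the mean value function of a non-homogeneous Poisson process). $(V_j)$ is i.i.d. with distribution $\Lambda(\mathrm{d}x)/\Lambda(1)$ on $[0,1]$, independent of $N$, and $R_{N(1)}(t)=\sum_{j=1}^{N(1)}\mu(t-V_j)$ for $t\ge1$. A superscript $(\ell,j)$ denotes $\ell$ derivatives in the first argument $y$ and $j$ derivatives in the second argument $z$; a superscript $(0)$ or $(0,0)$ means no differentiation. *)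

theory Defs
  imports "HOL-Probability.Probability"
begin

(* poisson_pmf is only specified for positive rates; rate 0 is the point mass at 0. *)
definition poisson_law :: "real \<Rightarrow> nat pmf" where
  "poisson_law r = (if r = 0 then return_pmf 0 else poisson_pmf r)"

(* N t counts the points in [0,t].  Setting N t = 0 for t < 0 lets the increment over (s,t]
   with s < 0 be N t itself, so that a point mass of the mean measure at 0 is allowed and
   N t is Poisson with mean L[0,t], the point 0 included. *)
definition nonhomogeneous_poisson_process ::
    "'a measure \<Rightarrow> real measure \<Rightarrow> (real \<Rightarrow> 'a \<Rightarrow> nat) \<Rightarrow> bool" where
  "nonhomogeneous_poisson_process M L N \<longleftrightarrow>
     prob_space M \<and>
     sets L = sets borel \<and> emeasure L {..<0} = 0 \<and>
     (\<forall>K. compact K \<longrightarrow> emeasure L K < \<infinity>) \<and>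
     (\<forall>t. N t \<in> measurable M (count_space UNIV)) \<and>
     (\<forall>\<omega>\<in>space M. (\<forall>t<0. N t \<omega> = 0) \<and> mono (\<lambda>t. N t \<omega>) \<and>
        (\<forall>t. continuous (at_right t) (\<lambda>u. real (N u \<omega>)))) \<and>
     (\<forall>s t. s \<le> t \<longrightarrow>
        distr M (count_space UNIV) (\<lambda>\<omega>. N t \<omega> - N s \<omega>)
          = measure_pmf (poisson_law (measure L {s<..t}))) \<and>
     (\<forall>t :: nat \<Rightarrow> real. incseq t \<longrightarrow>
        prob_space.indep_vars M (\<lambda>_. count_space UNIV)
          (\<lambda>i \<omega>. N (t (Suc i)) \<omega> - N (t i) \<omega>) UNIV)"

(* The whole process N and the whole sequence V 1, V 2, ... are independent. *)
definition indep_process_sequence ::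
    "'a measure \<Rightarrow> (real \<Rightarrow> 'a \<Rightarrow> nat) \<Rightarrow> (nat \<Rightarrow> 'a \<Rightarrow> real) \<Rightarrow> bool" where
  "indep_process_sequence M N V \<longleftrightarrow>
     prob_space.indep_set M
       (sigma_sets (space M) {N t -` A \<inter> space M | t A. t \<ge> 0})
       (sigma_sets (space M) {V j -` B \<inter> space M | j B. j \<ge> 1 \<and> B \<in> sets borel})"

definition random_sum ::
    "(real \<Rightarrow> 'a \<Rightarrow> nat) \<Rightarrow> (nat \<Rightarrow> 'a \<Rightarrow> real) \<Rightarrow> (real \<Rightarrow> real) \<Rightarrow> real \<Rightarrow> 'a \<Rightarrow> real" where
  "random_sum N V \<mu> t \<omega> = (\<Sum>j=1..N 1 \<omega>. \<mu> (t - V j \<omega>))"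

definition laplace_transform2 ::
    "'a measure \<Rightarrow> ('a \<Rightarrow> real) \<Rightarrow> ('a \<Rightarrow> real) \<Rightarrow> real \<Rightarrow> real \<Rightarrow> real" where
  "laplace_transform2 M X Y y z = (\<integral>\<omega>. exp (- y * X \<omega> - z * Y \<omega>) \<partial>M)"

definition psi ::
    "real measure \<Rightarrow> (real \<Rightarrow> real) \<Rightarrow> real \<Rightarrow> real \<Rightarrow> nat \<Rightarrow> real \<Rightarrow> real" where
  "psi L \<mu> t s j y =
     (LINT v:{0..1}|L. (- \<mu> (t + s - v)) ^ j * exp (- \<mu> (t - v) * y))"

definition partial_deriv ::
    "nat \<Rightarrow> nat \<Rightarrow> (real \<Rightarrow> real \<Rightarrow> real) \<Rightarrow> real \<Rightarrow> real \<Rightarrow> real" where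
  "partial_deriv l j f y z = (deriv ^^ l) (\<lambda>u. (deriv ^^ j) (f u) z) y"

(* deriv is total, so the existence of the iterated derivatives is recorded separately. *)
definition times_differentiable_at :: "nat \<Rightarrow> (real \<Rightarrow> real) \<Rightarrow> real \<Rightarrow> bool" where
  "times_differentiable_at n f x \<longleftrightarrow>
     (\<forall>k<n. \<forall>\<^sub>F u in nhds x. (deriv ^^ k) f field_differentiable (at u))"

definition partial_deriv_exists ::
    "nat \<Rightarrow> nat \<Rightarrow> (real \<Rightarrow> real \<Rightarrow> real) \<Rightarrow> real \<Rightarrow> real \<Rightarrow> bool" where
  "partial_deriv_exists l j f y z \<longleftrightarrow>
     (\<forall>\<^sub>F u in nhds y. times_differentiable_at j (f u) z) \<and>
     times_differentiable_at l (\<lambda>u. (deriv ^^ j) (f u) z) y"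

end

theory Submission
  imports Defs
begin

text \<open>
Put \<open>a v = \<mu> (t - v)\<close>, \<open>b v = \<mu> (t + s - v)\<close> and \<open>r = \<Lambda>[0,1]\<close>. The integrand of the Laplace transform
is a product over \<open>j = 1, ..., N 1\<close> of the independent, identically distributed factors
\<open>exp (- a (V j) * y - b (V j) * z)\<close>, and \<open>N 1\<close> is an independent Poisson variable of mean \<open>r\<close>. Hence
(\<open>expectation_prod_upto_poisson\<close>) the transform is the exponential of

  \<open>(\<integral>v. exp (- a v * y - b v * z) \<partial>\<Lambda>) - r\<close>,

with the integral over \<open>[0,1]\<close>. As \<open>\<mu>\<close> is monotone with a finite limit, \<open>a\<close> and \<open>b\<close> are bounded there, so
dominated convergence allows differentiation under the integral any number of times
(\<open>higher_deriv_exp_integral\<close>). Each derivative in \<open>y\<close> brings down \<open>- a\<close>, each derivative in \<open>z\<close> brings down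
\<open>- b\<close>. This gives the formula for the derivatives of \<open>\<psi>\<close>, and it shows that at \<open>z = 0\<close>

  \<open>\<partial>\<^sub>y \<phi> = \<phi> \<psi>\<^sub>0'\<close>,  \<open>\<partial>\<^sub>z \<phi> = \<phi> \<psi>\<^sub>1\<close>,  \<open>\<partial>\<^sub>z\<^sup>2 \<phi> = (\<partial>\<^sub>z \<phi>) \<psi>\<^sub>1 + \<phi> \<psi>\<^sub>2\<close>.

The three recursions are the Leibniz rule (\<open>leibniz_rule_higher_deriv\<close>) applied to these products in
the variable \<open>y\<close>. The existence of all the derivatives, which has to be established along with their values,
follows from the same products: the first equation bootstraps differentiability of \<open>\<phi>\<close> in \<open>y\<close> from one
order to the next (\<open>smooth_linear_ode\<close>), and the other two then express the \<open>z\<close>-derivatives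
by smooth functions.
\<close>

section \<open>Higher derivatives of products and of solutions of a linear equation\<close>

definition smooth :: "(real \<Rightarrow> real) \<Rightarrow> bool" where
  "smooth f \<longleftrightarrow> (\<forall>k x. (deriv ^^ k) f field_differentiable (at x))"

lemma smooth_imp_times_differentiable: "smooth f \<Longrightarrow> times_differentiable_at n f x"
  by (simp add: smooth_def times_differentiable_at_def)

lemma smooth_deriv: "smooth f \<Longrightarrow> smooth (deriv f)"
  unfolding smooth_def by (metis comp_apply funpow_Suc_right)

lemma has_deriv_higher_deriv:
  assumes "(deriv ^^ k) f field_differentiable (at x)"
  shows "((deriv ^^ k) f has_real_derivative (deriv ^^ Suc k) f x) (at x)"
  using assms by (simp add: DERIV_deriv_iff_field_differentiable)

text \<open>Only derivatives of order below \<open>n\<close> are required to be differentiable. This economy is what lets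
\<open>smooth_linear_ode\<close> apply the rule to a function whose smoothness is still being established.\<close>
lemma leibniz_rule_higher_deriv:
  fixes f g :: "real \<Rightarrow> real"
  assumes f: "\<And>k x. k < n \<Longrightarrow> (deriv ^^ k) f field_differentiable (at x)"
    and g: "\<And>k x. k < n \<Longrightarrow> (deriv ^^ k) g field_differentiable (at x)"
  shows "(deriv ^^ n) (\<lambda>x. f x * g x) =
    (\<lambda>x. \<Sum>k=0..n. real (n choose k) * (deriv ^^ k) f x * (deriv ^^ (n - k)) g x)"
  using assms
proof (induction n)
  case 0
  then show ?case by simp
next
  case (Suc n)
  have IH: "(deriv ^^ n) (\<lambda>x. f x * g x) =
      (\<lambda>x. \<Sum>k=0..n. real (n choose k) * (deriv ^^ k) f x * (deriv ^^ (n - k)) g x)"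
    using Suc by simp
  have "deriv (\<lambda>x. \<Sum>k=0..n. real (n choose k) * (deriv ^^ k) f x * (deriv ^^ (n - k)) g x) x =
      (\<Sum>k=0..Suc n. real (Suc n choose k) * (deriv ^^ k) f x * (deriv ^^ (Suc n - k)) g x)" for x
  proof -
    have "((\<lambda>x. \<Sum>k=0..n. real (n choose k) * (deriv ^^ k) f x * (deriv ^^ (n - k)) g x)
        has_real_derivative
        (\<Sum>k=0..n. real (n choose k) * (deriv ^^ Suc k) f x * (deriv ^^ (n - k)) g x +
           real (n choose k) * (deriv ^^ k) f x * (deriv ^^ Suc (n - k)) g x)) (at x)"
    proof (rule DERIV_sum)
      fix k assume k: "k \<in> {0..n}"
      have "((deriv ^^ k) f has_real_derivative (deriv ^^ Suc k) f x) (at x)"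
        "((deriv ^^ (n - k)) g has_real_derivative (deriv ^^ Suc (n - k)) g x) (at x)"
        using Suc.prems k by (auto intro!: has_deriv_higher_deriv simp del: funpow.simps)
      from DERIV_mult[OF DERIV_cmult[OF this(1), of "real (n choose k)"] this(2)]
      show "((\<lambda>x. real (n choose k) * (deriv ^^ k) f x * (deriv ^^ (n - k)) g x)
        has_real_derivative
        real (n choose k) * (deriv ^^ Suc k) f x * (deriv ^^ (n - k)) g x +
           real (n choose k) * (deriv ^^ k) f x * (deriv ^^ Suc (n - k)) g x) (at x)"
        by (simp only: mult_ac add_ac)
    qed
    also have "(\<Sum>k=0..n. real (n choose k) * (deriv ^^ Suc k) f x * (deriv ^^ (n - k)) g x +
           real (n choose k) * (deriv ^^ k) f x * (deriv ^^ Suc (n - k)) g x) =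
      (\<Sum>k=0..Suc n. real (Suc n choose k) * (deriv ^^ k) f x * (deriv ^^ (Suc n - k)) g x)"
    proof -
      define F where "F k = (deriv ^^ k) f x" for k
      define G where "G k = (deriv ^^ k) g x" for k
      have "(\<Sum>k=0..Suc n. real (Suc n choose k) * F k * G (Suc n - k)) =
          F 0 * G (Suc n) + (\<Sum>k=0..n. real (Suc n choose Suc k) * F (Suc k) * G (n - k))"
        by (simp add: sum.atLeast0_atMost_Suc_shift del: sum.cl_ivl_Suc binomial_Suc_Suc)
      also have "\<dots> = F 0 * G (Suc n) + (\<Sum>k=0..n. real (n choose k) * F (Suc k) * G (n - k))
          + (\<Sum>k=0..n. real (n choose Suc k) * F (Suc k) * G (n - k))"
        by (simp add: algebra_simps sum.distrib)
      also have "F 0 * G (Suc n) + (\<Sum>k=0..n. real (n choose Suc k) * F (Suc k) * G (n - k)) =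
          (\<Sum>k=0..Suc n. real (n choose k) * F k * G (Suc n - k))"
        by (simp add: sum.atLeast0_atMost_Suc_shift del: sum.cl_ivl_Suc)
      then have "F 0 * G (Suc n) + (\<Sum>k=0..n. real (n choose k) * F (Suc k) * G (n - k))
          + (\<Sum>k=0..n. real (n choose Suc k) * F (Suc k) * G (n - k)) =
          (\<Sum>k=0..n. real (n choose k) * F (Suc k) * G (n - k)) +
          (\<Sum>k=0..Suc n. real (n choose k) * F k * G (Suc n - k))"
        by simp
      also have "(\<Sum>k=0..Suc n. real (n choose k) * F k * G (Suc n - k)) =
          (\<Sum>k=0..n. real (n choose k) * F k * G (Suc (n - k)))"
        by (simp add: Suc_diff_le)
      finally show ?thesis
        unfolding F_def G_def by (simp add: sum.distrib)
    qed
    finally show ?thesis by (rule DERIV_imp_deriv)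
  qed
  then show ?case by (simp add: IH del: sum.cl_ivl_Suc binomial_Suc_Suc)
qed

lemma higher_deriv_mult_smooth:
  assumes "smooth f" "smooth g"
  shows "(deriv ^^ n) (\<lambda>x. f x * g x) x =
    (\<Sum>k=0..n. real (n choose k) * (deriv ^^ k) f x * (deriv ^^ (n - k)) g x)"
  using assms by (subst leibniz_rule_higher_deriv) (auto simp: smooth_def)

lemma field_differentiable_leibniz_sum:
  fixes f g :: "real \<Rightarrow> real"
  assumes "\<And>k x. k \<le> n \<Longrightarrow> (deriv ^^ k) f field_differentiable (at x)"
    and "\<And>k x. k \<le> n \<Longrightarrow> (deriv ^^ k) g field_differentiable (at x)"
  shows "(deriv ^^ n) (\<lambda>x. f x * g x) field_differentiable (at x)"
proof -
  have eq: "(deriv ^^ n) (\<lambda>x. f x * g x) =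
      (\<lambda>x. \<Sum>k=0..n. real (n choose k) * (deriv ^^ k) f x * (deriv ^^ (n - k)) g x)"
    using assms by (intro leibniz_rule_higher_deriv) auto
  show ?thesis
    unfolding eq
    by (intro field_differentiable_sum field_differentiable_mult field_differentiable_const assms) auto
qed

lemma smooth_mult:
  assumes "smooth f" "smooth g"
  shows "smooth (\<lambda>x. f x * g x)"
  using assms field_differentiable_leibniz_sum unfolding smooth_def by blast

lemma higher_deriv_add:
  assumes "smooth f" "smooth g"
  shows "(deriv ^^ n) (\<lambda>x. f x + g x) = (\<lambda>x. (deriv ^^ n) f x + (deriv ^^ n) g x)"
proof (induction n)
  case (Suc n)
  show ?case
    using assms by (simp add: Suc smooth_def fun_eq_iff)
qed simp

lemma smooth_add:
  assumes "smooth f" "smooth g"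
  shows "smooth (\<lambda>x. f x + g x)"
  using assms unfolding smooth_def higher_deriv_add[OF assms]
  by (auto intro: field_differentiable_add)

text \<open>If \<open>f' = f g\<close>, then the derivative of \<open>f\<close> of order \<open>m + 1\<close> is the derivative of \<open>f g\<close> of order \<open>m\<close>,
which by Leibniz involves only derivatives of \<open>f\<close> of order at most \<open>m\<close>. So differentiability climbs
from each order to the next. Exponentials of smooth functions satisfy such an equation.\<close>
lemma smooth_linear_ode:
  assumes f: "\<And>x. (f has_real_derivative f x * g x) (at x)" and g: "smooth g"
  shows "smooth f"
proof -
  have deriv_f: "deriv f = (\<lambda>x. f x * g x)"
    using f by (intro ext DERIV_imp_deriv)
  have "\<forall>x. (deriv ^^ n) f field_differentiable (at x)" for n
  proof (induction n rule: less_induct)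
    case (less n)
    show ?case
    proof (cases n)
      case 0
      then show ?thesis using f by (auto simp: field_differentiable_def)
    next
      case (Suc m)
      have "(deriv ^^ m) (\<lambda>x. f x * g x) field_differentiable (at x)" for x
        using less g by (intro field_differentiable_leibniz_sum) (auto simp: Suc smooth_def)
      then show ?thesis
        by (simp add: Suc funpow_Suc_right deriv_f del: funpow.simps)
    qed
  qed
  then show ?thesis by (simp add: smooth_def)
qed

section \<open>Differentiation under the integral sign\<close>

text \<open>This is the domination for the difference quotients of the exponential function.\<close>
lemma abs_exp_minus_one_le: "\<bar>exp u - 1\<bar> \<le> \<bar>u\<bar> * exp \<bar>u\<bar>" for u :: real
proof (cases "u \<ge> 0")
  case True
  have "(1 - u) * exp u \<le> exp (- u) * exp u"
    using exp_ge_add_one_self[of "- u"] by (intro mult_right_mono) auto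
  then show ?thesis using True by (simp add: exp_minus field_simps)
next
  case False
  have "1 + u \<le> exp u" "exp u \<le> 1"
    using False exp_ge_add_one_self[of u] by auto
  then have "\<bar>exp u - 1\<bar> \<le> \<bar>u\<bar> * 1"
    using False by linarith
  also have "\<dots> \<le> \<bar>u\<bar> * exp \<bar>u\<bar>" by (intro mult_left_mono) auto
  finally show ?thesis .
qed

text \<open>Since \<open>c\<close> and \<open>w\<close> are bounded and the measure is finite, the difference quotients of the integrand
along any sequence of increments tending to 0 are bounded by a constant, and dominated convergence
moves the limit inside.\<close>
lemma (in finite_measure) has_derivative_exp_integral:
  fixes w c :: "'a \<Rightarrow> real"
  assumes [measurable]: "w \<in> borel_measurable M" "c \<in> borel_measurable M"
    and w: "\<And>x. x \<in> space M \<Longrightarrow> \<bar>w x\<bar> \<le> B" and c: "\<And>x. x \<in> space M \<Longrightarrow> \<bar>c x\<bar> \<le> C"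
  shows "((\<lambda>y. \<integral>x. w x * exp (c x * y) \<partial>M) has_real_derivative
           (\<integral>x. w x * c x * exp (c x * y) \<partial>M)) (at y)"
proof -
  have exp_le: "\<bar>exp (c x * h)\<bar> \<le> exp (C * \<bar>h\<bar>)" if "x \<in> space M" for x h
  proof -
    have "c x * h \<le> \<bar>c x\<bar> * \<bar>h\<bar>" by (metis abs_ge_self abs_mult)
    also have "\<dots> \<le> C * \<bar>h\<bar>" using c[OF that] by (intro mult_right_mono) auto
    finally show ?thesis by simp
  qed
  have int: "integrable M (\<lambda>x. w x * exp (c x * u))" for u
  proof (rule integrable_const_bound[where B = "B * exp (C * \<bar>u\<bar>)"])
    show "AE x in M. norm (w x * exp (c x * u)) \<le> B * exp (C * \<bar>u\<bar>)"
    proof (rule AE_I2)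
      fix x assume x: "x \<in> space M"
      have "0 \<le> B" using w[OF x] by linarith
      then show "norm (w x * exp (c x * u)) \<le> B * exp (C * \<bar>u\<bar>)"
        unfolding real_norm_def abs_mult using w[OF x] exp_le[OF x] by (intro mult_mono) auto
    qed
  qed simp
  show ?thesis
    unfolding has_field_derivative_iff tendsto_at_iff_sequentially comp_def
  proof safe
    fix X :: "nat \<Rightarrow> real" assume X: "\<forall>n. X n \<in> UNIV - {y}" "X \<longlonglongrightarrow> y"
    define h where "h n = X n - y" for n
    have h: "h n \<noteq> 0" for n using X(1) by (auto simp: h_def)
    have h0: "h \<longlonglongrightarrow> 0" unfolding h_def using X(2) by (simp add: LIM_zero)
    \<comment> \<open>A convergent sequence of increments is bounded, which gives one constant that dominates
      every quotient.\<close>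
    then have "Bseq h" by (intro convergent_imp_Bseq) (auto simp: convergent_def)
    then obtain D where D: "\<And>n. \<bar>h n\<bar> \<le> D" by (auto simp: Bseq_def)
    define q where "q n x = w x * exp (c x * y) * ((exp (c x * h n) - 1) / h n)" for n x
    have quot: "((\<integral>x. w x * exp (c x * X n) \<partial>M) - (\<integral>x. w x * exp (c x * y) \<partial>M)) / (X n - y)
        = (\<integral>x. q n x \<partial>M)" for n
    proof -
      have *: "exp (c x * X n) = exp (c x * y) * exp (c x * h n)" for x
        by (simp add: h_def algebra_simps flip: exp_add)
      have "(\<integral>x. q n x \<partial>M) = (\<integral>x. (w x * exp (c x * X n) - w x * exp (c x * y)) / h n \<partial>M)"
        unfolding q_def *
        by (intro Bochner_Integration.integral_cong)
          (simp_all add: right_diff_distrib diff_divide_distrib mult_ac)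
      also have "\<dots> = (\<integral>x. (w x * exp (c x * X n) - w x * exp (c x * y)) \<partial>M) / h n"
        by simp
      finally show ?thesis
        by (simp add: Bochner_Integration.integral_diff[OF int int] h_def)
    qed
    have "(\<lambda>n. \<integral>x. q n x \<partial>M) \<longlonglongrightarrow> (\<integral>x. w x * c x * exp (c x * y) \<partial>M)"
    proof (rule integral_dominated_convergence[where w = "\<lambda>_. B * exp (C * \<bar>y\<bar>) * (C * exp (C * D))"])
      show "AE x in M. (\<lambda>n. q n x) \<longlonglongrightarrow> w x * c x * exp (c x * y)"
      proof (rule AE_I2)
        fix x
        have "((\<lambda>u. exp (c x * u)) has_real_derivative c x) (at 0)"
          by (auto intro!: derivative_eq_intros)
        then have "((\<lambda>u. (exp (c x * u) - 1) / u) \<longlongrightarrow> c x) (at 0)"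
          by (simp add: has_field_derivative_iff)
        then have "(\<lambda>n. (exp (c x * h n) - 1) / h n) \<longlonglongrightarrow> c x"
          using h h0 by (auto simp: tendsto_at_iff_sequentially comp_def)
        then have "(\<lambda>n. q n x) \<longlonglongrightarrow> w x * exp (c x * y) * c x"
          unfolding q_def by (intro tendsto_intros)
        then show "(\<lambda>n. q n x) \<longlonglongrightarrow> w x * c x * exp (c x * y)" by (simp add: mult_ac)
      qed
      show "AE x in M. norm (q n x) \<le> B * exp (C * \<bar>y\<bar>) * (C * exp (C * D))" for n
      proof (rule AE_I2)
        fix x assume x: "x \<in> space M"
        have C0: "0 \<le> C" using c[OF x] by linarith
        have B0: "0 \<le> B" using w[OF x] by linarith
        have ch: "\<bar>c x * h n\<bar> \<le> C * \<bar>h n\<bar>"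
          using c[OF x] by (auto simp: abs_mult intro: mult_right_mono)
        also have "\<dots> \<le> C * D" using D C0 by (intro mult_left_mono) auto
        finally have chD: "\<bar>c x * h n\<bar> \<le> C * D" .
        have "\<bar>exp (c x * h n) - 1\<bar> \<le> \<bar>c x * h n\<bar> * exp \<bar>c x * h n\<bar>"
          by (rule abs_exp_minus_one_le)
        also have "\<dots> \<le> C * \<bar>h n\<bar> * exp (C * D)"
          using ch chD C0 by (intro mult_mono) auto
        finally have "\<bar>(exp (c x * h n) - 1) / h n\<bar> \<le> C * exp (C * D)"
          using h[of n] by (simp add: abs_divide divide_le_eq mult_ac)
        moreover have "\<bar>w x * exp (c x * y)\<bar> \<le> B * exp (C * \<bar>y\<bar>)"
          using w[OF x] exp_le[OF x, of y] B0 by (auto simp: abs_mult intro!: mult_mono)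
        ultimately show "norm (q n x) \<le> B * exp (C * \<bar>y\<bar>) * (C * exp (C * D))"
          unfolding q_def real_norm_def abs_mult[of "w x * exp (c x * y)"]
          using B0 by (intro mult_mono) auto
      qed
    qed (auto simp: q_def)
    then show "(\<lambda>n. ((\<integral>x. w x * exp (c x * X n) \<partial>M) - (\<integral>x. w x * exp (c x * y) \<partial>M)) / (X n - y))
        \<longlonglongrightarrow> (\<integral>x. w x * c x * exp (c x * y) \<partial>M)"
      by (simp add: quot)
  qed
qed

text \<open>Differentiating once multiplies the weight \<open>w\<close> by \<open>c\<close>, and the new weight is again bounded, so the
step can be repeated indefinitely.\<close>
lemma (in finite_measure)
  fixes w c :: "'a \<Rightarrow> real"
  assumes [measurable]: "w \<in> borel_measurable M" "c \<in> borel_measurable M"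
    and w: "\<And>x. x \<in> space M \<Longrightarrow> \<bar>w x\<bar> \<le> B" and c: "\<And>x. x \<in> space M \<Longrightarrow> \<bar>c x\<bar> \<le> C"
  shows higher_deriv_exp_integral: "(deriv ^^ n) (\<lambda>y. \<integral>x. w x * exp (c x * y) \<partial>M) =
      (\<lambda>y. \<integral>x. w x * c x ^ n * exp (c x * y) \<partial>M)" (is "?A n")
    and smooth_exp_integral: "smooth (\<lambda>y. \<integral>x. w x * exp (c x * y) \<partial>M)"
proof -
  have D: "((\<lambda>y. \<integral>x. w x * c x ^ n * exp (c x * y) \<partial>M) has_real_derivative
      (\<integral>x. w x * c x ^ Suc n * exp (c x * y) \<partial>M)) (at y)" for n y
  proof -
    have "((\<lambda>y. \<integral>x. w x * c x ^ n * exp (c x * y) \<partial>M) has_real_derivative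
      (\<integral>x. w x * c x ^ n * c x * exp (c x * y) \<partial>M)) (at y)"
    proof (rule has_derivative_exp_integral)
      fix x assume x: "x \<in> space M"
      have "\<bar>c x\<bar> ^ n \<le> C ^ n" using c[OF x] by (intro power_mono) auto
      then show "\<bar>w x * c x ^ n\<bar> \<le> B * C ^ n"
        using w[OF x] by (auto simp: abs_mult power_abs intro!: mult_mono)
    qed (use c in auto)
    then show ?thesis by (simp add: mult_ac)
  qed
  have *: "?A n" for n
  proof (induction n)
    case (Suc n)
    show ?case using D by (auto simp: Suc intro!: ext DERIV_imp_deriv)
  qed simp
  show "?A n" by (rule *)
  show "smooth (\<lambda>y. \<integral>x. w x * exp (c x * y) \<partial>M)"
    unfolding smooth_def * using D by (auto simp: field_differentiable_def)
qed

section \<open>Random products with a Poisson number of factors\<close>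

lemma (in prob_space) indep_set_mono:
  assumes "indep_set A B" "A' \<subseteq> A" "B' \<subseteq> B"
  shows "indep_set A' B'"
  using assms unfolding indep_set_def
  by (elim indep_sets_mono_sets) (auto split: bool.split)

text \<open>Condition on the value of \<open>N\<close>: on the event \<open>N = n\<close> the product has \<open>n\<close> factors, so independence
gives the series of \<open>P(N = n) m^n\<close>, which is the Poisson generating function at \<open>m\<close>. All terms being
nonnegative, sum and expectation may be exchanged.\<close>
lemma (in prob_space) expectation_prod_upto_poisson:
  fixes N :: "'a \<Rightarrow> nat" and X :: "nat \<Rightarrow> 'a \<Rightarrow> real"
  assumes N: "distr M (count_space UNIV) N = measure_pmf (poisson_pmf r)" and r: "r > 0"
    and N_meas [measurable]: "N \<in> measurable M (count_space UNIV)"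
    and X: "indep_vars (\<lambda>_. borel) X {1..}"
    and nonneg: "\<And>j \<omega>. j \<ge> 1 \<Longrightarrow> \<omega> \<in> space M \<Longrightarrow> 0 \<le> X j \<omega>"
    and int: "\<And>j. j \<ge> 1 \<Longrightarrow> integrable M (X j)" and m: "\<And>j. j \<ge> 1 \<Longrightarrow> expectation (X j) = m"
    and indep: "indep_set (sigma_sets (space M) {N -` A \<inter> space M | A. True})
      (sigma_sets (space M) {X j -` B \<inter> space M | j B. j \<ge> 1 \<and> B \<in> sets borel})"
  shows "expectation (\<lambda>\<omega>. \<Prod>j=1..N \<omega>. X j \<omega>) = exp (r * m - r)"
proof -
  define T where "T n \<omega> = indicator {n} (N \<omega>) * (\<Prod>j=1..n. X j \<omega>)" for n \<omega>
  have X': "indep_vars (\<lambda>_. borel) X {1..n}" for n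
    using X by (rule indep_vars_subset) auto
  have prod_int: "integrable M (\<lambda>\<omega>. \<Prod>j=1..n. X j \<omega>)" for n
    by (rule indep_vars_integrable[OF _ X']) (auto intro: int)
  have prod_eq: "expectation (\<lambda>\<omega>. \<Prod>j=1..n. X j \<omega>) = m ^ n" for n
    by (subst indep_vars_lebesgue_integral[OF _ X']) (auto intro: int simp: m)
  have ind_int: "integrable M (\<lambda>\<omega>. indicator {n} (N \<omega>) :: real)" for n
    by (rule integrable_const_bound[where B = 1]) (auto simp: indicator_def)
  have ind_eq: "expectation (\<lambda>\<omega>. indicator {n} (N \<omega>)) = r ^ n / fact n * exp (- r)" for n
  proof -
    have "expectation (\<lambda>\<omega>. indicator {n} (N \<omega>) :: real) =
        (\<integral>k. indicator {n} k \<partial>distr M (count_space UNIV) N)"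
      by (subst integral_distr) auto
    also have "\<dots> = r ^ n / fact n * exp (- r)"
      using r by (simp add: N measure_pmf_single)
    finally show ?thesis .
  qed
  have iv: "indep_var borel (\<lambda>\<omega>. indicator {n} (N \<omega>) :: real) borel (\<lambda>\<omega>. \<Prod>j=1..n. X j \<omega>)" for n
  proof -
    define E where "E = {X j -` B \<inter> space M | j B. j \<ge> 1 \<and> B \<in> sets (borel :: real measure)}"
    have E: "E \<subseteq> Pow (space M)" by (auto simp: E_def)
    \<comment> \<open>The finite products are measurable for the sigma-algebra generated by the whole
      sequence, so they inherit its independence of \<open>N\<close>.\<close>
    have X_E: "X j \<in> borel_measurable (sigma (space M) E)" if "j \<ge> 1" for j
      using that E by (intro measurableI) (auto simp: E_def space_measure_of_conv)
    have "(\<lambda>\<omega>. \<Prod>j=1..n. X j \<omega>) \<in> borel_measurable (sigma (space M) E)"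
      using X_E by (intro borel_measurable_prod) auto
    from measurable_sets[OF this]
    have "(\<lambda>\<omega>. \<Prod>j=1..n. X j \<omega>) -` B \<inter> space M \<in> sigma_sets (space M) E"
      if "B \<in> sets borel" for B
      using that E by (simp add: space_measure_of_conv)
    then have sub: "sigma_sets (space M) {(\<lambda>\<omega>. \<Prod>j=1..n. X j \<omega>) -` B \<inter> space M | B. B \<in> sets borel}
        \<subseteq> sigma_sets (space M) E"
      by (intro sigma_sets_mono) auto
    have "(\<lambda>\<omega>. indicator {n} (N \<omega>) :: real) -` B \<inter> space M = N -` (indicator {n} -` B) \<inter> space M" for B
      by auto
    then have sub': "sigma_sets (space M) {(\<lambda>\<omega>. indicator {n} (N \<omega>) :: real) -` B \<inter> space M | B. B \<in> sets borel}
        \<subseteq> sigma_sets (space M) {N -` A \<inter> space M | A. True}"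
      by (intro sigma_sets_mono' subsetI, elim CollectE exE conjE) (simp, rule exI, rule refl)
    show ?thesis
      unfolding indep_var_eq
      using indep_set_mono[OF indep[folded E_def] sub' sub] borel_measurable_integrable[OF prod_int]
        borel_measurable_integrable[OF ind_int]
      by simp
  qed
  have T_int: "integrable M (T n)" for n
    unfolding T_def by (rule indep_var_integrable[OF iv ind_int prod_int])
  have T_eq: "expectation (T n) = (r * m) ^ n / fact n * exp (- r)" for n
    unfolding T_def indep_var_lebesgue_integral[OF iv ind_int prod_int] ind_eq prod_eq
    by (simp add: power_mult_distrib)
  have T_nonneg: "0 \<le> T n \<omega>" if "\<omega> \<in> space M" for n \<omega>
    unfolding T_def using nonneg that by (intro mult_nonneg_nonneg prod_nonneg) auto
  have T_sums: "(\<lambda>n. T n \<omega>) sums (\<Prod>j=1..N \<omega>. X j \<omega>)" for \<omega>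
  proof -
    have "(\<lambda>n. T n \<omega>) = (\<lambda>n. if n = N \<omega> then \<Prod>j=1..n. X j \<omega> else 0)"
      by (auto simp: T_def)
    then show ?thesis
      using sums_single[of "N \<omega>" "\<lambda>n. \<Prod>j=1..n. X j \<omega>"] by simp
  qed
  have E_sums: "(\<lambda>n. expectation (T n)) sums exp (r * m - r)"
    using sums_mult2[OF exp_converges[of "r * m"], of "exp (- r)"]
    unfolding T_eq by (simp add: divide_inverse exp_diff exp_minus mult_ac)
  have "expectation (\<lambda>\<omega>. \<Prod>j=1..N \<omega>. X j \<omega>) = expectation (\<lambda>\<omega>. \<Sum>n. T n \<omega>)"
    using T_sums by (simp add: sums_iff)
  also have "\<dots> = (\<Sum>n. expectation (T n))"
  proof (rule integral_suminf[OF T_int])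
    show "AE \<omega> in M. summable (\<lambda>n. norm (T n \<omega>))"
    proof (rule AE_I2)
      fix \<omega> assume "\<omega> \<in> space M"
      then show "summable (\<lambda>n. norm (T n \<omega>))" using T_sums[of \<omega>] T_nonneg by (simp add: sums_iff)
    qed
    have "(\<integral>\<omega>. norm (T n \<omega>) \<partial>M) = expectation (T n)" for n
      using T_nonneg by (intro Bochner_Integration.integral_cong) auto
    then show "summable (\<lambda>n. \<integral>\<omega>. norm (T n \<omega>) \<partial>M)" using E_sums by (simp add: sums_iff)
  qed
  also have "\<dots> = exp (r * m - r)" using E_sums by (simp add: sums_iff)
  finally show ?thesis .
qed

section \<open>Derivatives of the compound Poisson Laplace transform\<close>

text \<open>\<open>Phi\<close> is the bivariate Laplace transform of a pair of compound Poisson sums: if \<open>M\<close> has total mass \<open>r\<close>,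
then it is the transform of the sums of \<open>a\<close> and of \<open>b\<close> over the points of a Poisson process with mean
measure \<open>M\<close>. In general \<open>r\<close> only contributes a constant factor, so it stays a parameter of its own.\<close>
locale exponential_mixture = finite_measure M for M :: "'a measure" +
  fixes a b :: "'a \<Rightarrow> real" and C r :: real
  assumes a_meas [measurable]: "a \<in> borel_measurable M" and b_meas [measurable]: "b \<in> borel_measurable M"
    and a_bound: "\<And>x. x \<in> space M \<Longrightarrow> \<bar>a x\<bar> \<le> C" and b_bound: "\<And>x. x \<in> space M \<Longrightarrow> \<bar>b x\<bar> \<le> C"
begin

definition Psi :: "nat \<Rightarrow> real \<Rightarrow> real" where
  "Psi j y = (\<integral>x. (- b x) ^ j * exp (- a x * y) \<partial>M)"

definition Phi :: "real \<Rightarrow> real \<Rightarrow> real" where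
  "Phi y z = exp ((\<integral>x. exp (- a x * y - b x * z) \<partial>M) - r)"

lemma power_bound: "x \<in> space M \<Longrightarrow> \<bar>(- b x) ^ j\<bar> \<le> C ^ j"
  unfolding power_abs abs_minus_cancel by (intro power_mono b_bound) auto

lemma higher_deriv_Psi:
  "(deriv ^^ n) (Psi j) y = (\<integral>x. (- b x) ^ j * (- a x) ^ n * exp (- a x * y) \<partial>M)"
proof -
  have "(deriv ^^ n) (Psi j) = (\<lambda>y. \<integral>x. (- b x) ^ j * (- a x) ^ n * exp (- a x * y) \<partial>M)"
    unfolding Psi_def
    by (rule higher_deriv_exp_integral) (use power_bound a_bound in auto)
  then show ?thesis by simp
qed

lemma smooth_Psi: "smooth (Psi j)"
  unfolding Psi_def by (rule smooth_exp_integral) (use power_bound a_bound in auto)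

text \<open>For fixed \<open>y\<close> the function \<open>P\<close> of \<open>z\<close> in the exponent has the derivatives \<open>Psi n y\<close> at 0, because each
differentiation in \<open>z\<close> brings down a factor \<open>- b\<close>. The derivatives of \<open>Phi y\<close> then come from the
equation \<open>Phi' = Phi P'\<close>, differentiated once more for the second order.\<close>
lemma
  shows smooth_Phi_right: "smooth (Phi y)"
    and deriv_Phi_right: "deriv (Phi y) 0 = Phi y 0 * Psi 1 y"
    and deriv2_Phi_right: "(deriv ^^ 2) (Phi y) 0 = deriv (Phi y) 0 * Psi 1 y + Phi y 0 * Psi 2 y"
proof -
  define w where "w x = exp (- a x * y)" for x
  define P where "P z = (\<integral>x. w x * exp (- b x * z) \<partial>M)" for z
  have [measurable]: "w \<in> borel_measurable M" by (simp add: w_def[abs_def])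
  have w: "\<bar>w x\<bar> \<le> exp (C * \<bar>y\<bar>)" if "x \<in> space M" for x
  proof -
    have "- a x * y \<le> \<bar>a x\<bar> * \<bar>y\<bar>" by (metis abs_ge_self abs_minus_cancel abs_mult)
    also have "\<dots> \<le> C * \<bar>y\<bar>" using a_bound[OF that] by (intro mult_right_mono) auto
    finally show ?thesis by (simp add: w_def)
  qed
  have Phi_P: "Phi y = (\<lambda>z. exp (P z - r))"
    by (simp add: Phi_def P_def w_def fun_eq_iff flip: exp_add)
  have smooth_P: "smooth P"
    unfolding P_def by (rule smooth_exp_integral) (use w b_bound in auto)
  have "(deriv ^^ n) P = (\<lambda>z. \<integral>x. w x * (- b x) ^ n * exp (- b x * z) \<partial>M)" for n
    unfolding P_def by (rule higher_deriv_exp_integral) (use w b_bound in auto)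
  then have P0: "(deriv ^^ n) P 0 = Psi n y" for n
    by (simp add: Psi_def w_def mult.commute)
  have P_deriv: "(P has_real_derivative deriv P z) (at z)" for z
    using smooth_P[unfolded smooth_def, rule_format, of 0 z]
    by (simp add: DERIV_deriv_iff_field_differentiable)
  have Phi_deriv: "(Phi y has_real_derivative Phi y z * deriv P z) (at z)" for z
    unfolding Phi_P by (auto intro!: derivative_eq_intros P_deriv)
  show smooth: "smooth (Phi y)"
    using Phi_deriv smooth_deriv[OF smooth_P] by (rule smooth_linear_ode)
  have deriv_Phi: "deriv (Phi y) = (\<lambda>z. Phi y z * deriv P z)"
    using Phi_deriv by (intro ext DERIV_imp_deriv)
  show 1: "deriv (Phi y) 0 = Phi y 0 * Psi 1 y"
    using P0[of 1] by (simp add: deriv_Phi)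
  have "((\<lambda>z. Phi y z * deriv P z) has_real_derivative
      Phi y 0 * deriv P 0 * deriv P 0 + deriv (deriv P) 0 * Phi y 0) (at 0)"
    using Phi_deriv smooth_deriv[OF smooth_P, unfolded smooth_def, rule_format, of 0 0]
    by (intro DERIV_mult) (auto simp: DERIV_deriv_iff_field_differentiable)
  then have "deriv (deriv (Phi y)) 0 =
      Phi y 0 * deriv P 0 * deriv P 0 + deriv (deriv P) 0 * Phi y 0"
    unfolding deriv_Phi by (rule DERIV_imp_deriv)
  then show "(deriv ^^ 2) (Phi y) 0 = deriv (Phi y) 0 * Psi 1 y + Phi y 0 * Psi 2 y"
    using P0[of 1] P0[of 2] by (simp add: 1 numeral_2_eq_2 mult.commute)
qed

text \<open>On the line \<open>z = 0\<close> the exponent is \<open>Psi 0 y - r\<close>.\<close>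
lemma has_derivative_Phi_left:
  "((\<lambda>y. Phi y 0) has_real_derivative Phi y 0 * deriv (Psi 0) y) (at y)"
proof -
  have Phi_Psi: "(\<lambda>y. Phi y 0) = (\<lambda>y. exp (Psi 0 y - r))"
    by (simp add: Phi_def Psi_def)
  have "(Psi 0 has_real_derivative deriv (Psi 0) y) (at y)"
    using smooth_Psi[unfolded smooth_def, rule_format, of 0 0 y]
    by (simp add: DERIV_deriv_iff_field_differentiable)
  then have "((\<lambda>y. exp (Psi 0 y - r)) has_real_derivative exp (Psi 0 y - r) * deriv (Psi 0) y) (at y)"
    by (auto intro!: derivative_eq_intros)
  then show ?thesis using Phi_Psi by (metis (lifting))
qed

lemma smooth_Phi_left: "smooth (\<lambda>y. Phi y 0)"
  using has_derivative_Phi_left smooth_deriv[OF smooth_Psi] by (rule smooth_linear_ode)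

text \<open>One derivative is spent on passing from \<open>Phi\<close> to the product \<open>Phi * deriv (Psi 0)\<close>, and Leibniz
distributes the remaining \<open>l - 1\<close>. In the other two recursions the product is already provided by
the derivatives in \<open>z\<close>, so all \<open>l\<close> derivatives in \<open>y\<close> are distributed.\<close>
lemma partial_deriv_Phi_0:
  assumes "l \<ge> 1"
  shows "partial_deriv l 0 Phi y 0 =
    (\<Sum>k=0..l-1. real ((l-1) choose k) * partial_deriv k 0 Phi y 0 * (deriv ^^ (l-k)) (Psi 0) y)"
proof -
  obtain n where l: "l = Suc n" using assms by (cases l) auto
  have "deriv (\<lambda>y. Phi y 0) = (\<lambda>y. Phi y 0 * deriv (Psi 0) y)"
    using has_derivative_Phi_left by (intro ext DERIV_imp_deriv)
  then have "partial_deriv l 0 Phi y 0 = (deriv ^^ n) (\<lambda>y. Phi y 0 * deriv (Psi 0) y) y"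
    by (simp add: partial_deriv_def l funpow_Suc_right del: funpow.simps(2))
  also have "\<dots> = (\<Sum>k=0..n. real (n choose k) * (deriv ^^ k) (\<lambda>y. Phi y 0) y *
      (deriv ^^ (n - k)) (deriv (Psi 0)) y)"
    by (intro higher_deriv_mult_smooth smooth_Phi_left smooth_deriv smooth_Psi)
  also have "\<dots> = (\<Sum>k=0..n. real (n choose k) * (deriv ^^ k) (\<lambda>y. Phi y 0) y *
      (deriv ^^ (Suc n - k)) (Psi 0) y)"
    by (intro sum.cong refl) (simp add: Suc_diff_le funpow_Suc_right del: funpow.simps(2))
  finally show ?thesis by (simp add: partial_deriv_def l)
qed

lemma smooth_Phi_left_deriv: "smooth (\<lambda>y. deriv (Phi y) 0)"
  unfolding deriv_Phi_right by (intro smooth_mult smooth_Phi_left smooth_Psi)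

lemma partial_deriv_Phi_1:
  "partial_deriv l 1 Phi y 0 =
    (\<Sum>k=0..l. real (l choose k) * partial_deriv k 0 Phi y 0 * (deriv ^^ (l-k)) (Psi 1) y)"
proof -
  have "partial_deriv l 1 Phi y 0 = (deriv ^^ l) (\<lambda>y. Phi y 0 * Psi 1 y) y"
    by (simp only: partial_deriv_def One_nat_def funpow.simps o_id deriv_Phi_right)
  also have "\<dots> = (\<Sum>k=0..l. real (l choose k) * (deriv ^^ k) (\<lambda>y. Phi y 0) y * (deriv ^^ (l-k)) (Psi 1) y)"
    by (rule higher_deriv_mult_smooth[OF smooth_Phi_left smooth_Psi])
  finally show ?thesis by (simp only: partial_deriv_def funpow_0)
qed

lemma partial_deriv_Phi_2:
  "partial_deriv l 2 Phi y 0 =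
    (\<Sum>k=0..l. real (l choose k) * partial_deriv k 1 Phi y 0 * (deriv ^^ (l-k)) (Psi 1) y) +
    (\<Sum>k=0..l. real (l choose k) * partial_deriv k 0 Phi y 0 * (deriv ^^ (l-k)) (Psi 2) y)"
proof -
  have "partial_deriv l 2 Phi y 0 =
      (deriv ^^ l) (\<lambda>y. deriv (Phi y) 0 * Psi 1 y + Phi y 0 * Psi 2 y) y"
    by (simp only: partial_deriv_def deriv2_Phi_right)
  also have "\<dots> = (deriv ^^ l) (\<lambda>y. deriv (Phi y) 0 * Psi 1 y) y + (deriv ^^ l) (\<lambda>y. Phi y 0 * Psi 2 y) y"
    by (subst higher_deriv_add) (intro smooth_mult smooth_Phi_left smooth_Phi_left_deriv smooth_Psi refl)+
  finally show ?thesis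
    unfolding higher_deriv_mult_smooth[OF smooth_Phi_left_deriv smooth_Psi]
      higher_deriv_mult_smooth[OF smooth_Phi_left smooth_Psi]
    by (simp add: partial_deriv_def)
qed

lemma partial_deriv_exists_Phi:
  assumes "j \<le> 2"
  shows "partial_deriv_exists l j Phi y 0"
proof -
  have "smooth (\<lambda>y. deriv (Phi y) 0 * Psi 1 y + Phi y 0 * Psi 2 y)"
    by (intro smooth_add smooth_mult smooth_Phi_left_deriv smooth_Phi_left smooth_Psi)
  then have "smooth (\<lambda>y. (deriv ^^ 2) (Phi y) 0)"
    by (simp only: deriv2_Phi_right)
  moreover have "j = 0 \<or> j = 1 \<or> j = 2" using assms by linarith
  ultimately have "smooth (\<lambda>y. (deriv ^^ j) (Phi y) 0)"
    using smooth_Phi_left smooth_Phi_left_deriv by (elim disjE) simp_all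
  then show ?thesis
    by (simp add: partial_deriv_exists_def smooth_imp_times_differentiable smooth_Phi_right)
qed

end

section \<open>The Laplace transform of the random sum\<close>

lemma mono_on_tendsto_at_top_le:
  fixes f :: "real \<Rightarrow> real"
  assumes "mono_on {a..} f" "(f \<longlongrightarrow> c) at_top" "x \<ge> a"
  shows "f x \<le> c"
proof (rule tendsto_lowerbound[OF assms(2)])
  show "\<forall>\<^sub>F u in at_top. f x \<le> f u"
    using eventually_ge_at_top[of x] by eventually_elim (use assms in \<open>auto intro: mono_onD\<close>)
qed simp

lemma integral_uniform_measure:
  fixes f :: "'a \<Rightarrow> real"
  assumes "A \<in> sets M" "emeasure M A \<noteq> 0" "emeasure M A \<noteq> \<infinity>" "f \<in> borel_measurable M"
  shows "(\<integral>x. f x \<partial>uniform_measure M A) = (LINT x:A|M. f x) / measure M A"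
proof -
  have A: "emeasure M A = ennreal (measure M A)" "measure M A > 0"
    using assms(2,3) by (simp_all add: emeasure_eq_ennreal_measure zero_less_measure_iff)
  have "uniform_measure M A = density M (\<lambda>x. ennreal (indicator A x / measure M A))"
    unfolding uniform_measure_def A(1)
    by (intro density_cong AE_I2)
      (use assms(1) A(2) in \<open>auto simp: divide_ennreal indicator_def simp flip: ennreal_1\<close>)
  then have "(\<integral>x. f x \<partial>uniform_measure M A) = (\<integral>x. indicator A x / measure M A * f x \<partial>M)"
    using assms A(2) by (simp add: integral_real_density)
  then show ?thesis
    by (simp add: set_lebesgue_integral_def)
qed

theorem lemma2p5:
  fixes M :: "'a measure" and \<Lambda> :: "real measure"
    and N :: "real \<Rightarrow> 'a \<Rightarrow> nat" and V :: "nat \<Rightarrow> 'a \<Rightarrow> real"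
    and \<mu> :: "real \<Rightarrow> real" and t s :: real and l :: nat
    and \<phi> :: "real \<Rightarrow> real \<Rightarrow> real" and \<psi> :: "nat \<Rightarrow> real \<Rightarrow> real"
  assumes "nonhomogeneous_poisson_process M \<Lambda> N"
    and "0 < emeasure \<Lambda> {0..1}" and "emeasure \<Lambda> {0..1} < \<infinity>"
    and "\<mu> \<in> {0..} \<rightarrow> {0..}" and "mono_on {0..} \<mu>" and "continuous_on {0..} \<mu>"
    and "\<mu> 0 = 0" and "\<exists>c. (\<mu> \<longlongrightarrow> c) at_top"
    and "\<And>j. j \<ge> 1 \<Longrightarrow> V j \<in> space M \<rightarrow> {0..1}"
    and "prob_space.indep_vars M (\<lambda>_. borel) V {1..}"
    and "\<And>j. j \<ge> 1 \<Longrightarrow> distr M borel (V j) = uniform_measure \<Lambda> {0..1}"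
    and "indep_process_sequence M N V"
    and "t \<ge> 1" and "s > 0" and "l \<ge> 1"
    and "\<phi> = laplace_transform2 M (random_sum N V \<mu> t) (random_sum N V \<mu> (t + s))"
    and "\<psi> = psi \<Lambda> \<mu> t s"
  shows "(\<forall>j\<le>2. partial_deriv_exists l j \<phi> 1 0 \<and> times_differentiable_at l (\<psi> j) 1) \<and>
    (\<forall>j\<le>2. (deriv ^^ l) (\<psi> j) 1 =
       (LINT v:{0..1}|\<Lambda>. (- \<mu> (t + s - v)) ^ j * (- \<mu> (t - v)) ^ l * exp (- \<mu> (t - v)))) \<and>
    partial_deriv l 0 \<phi> 1 0 =
       (\<Sum>k=0..l-1. real ((l-1) choose k) * partial_deriv k 0 \<phi> 1 0 * (deriv ^^ (l-k)) (\<psi> 0) 1) \<and>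
    partial_deriv l 1 \<phi> 1 0 =
       (\<Sum>k=0..l. real (l choose k) * partial_deriv k 0 \<phi> 1 0 * (deriv ^^ (l-k)) (\<psi> 1) 1) \<and>
    partial_deriv l 2 \<phi> 1 0 =
       (\<Sum>k=0..l. real (l choose k) * partial_deriv k 1 \<phi> 1 0 * (deriv ^^ (l-k)) (\<psi> 1) 1) +
       (\<Sum>k=0..l. real (l choose k) * partial_deriv k 0 \<phi> 1 0 * (deriv ^^ (l-k)) (\<psi> 2) 1)"

proof -
  define r where "r = measure \<Lambda> {0..1}"
  have prob: "prob_space M" and sets_\<Lambda>: "sets \<Lambda> = sets borel" and neg: "emeasure \<Lambda> {..<0} = 0"
    and N_meas: "\<And>t. N t \<in> measurable M (count_space UNIV)"
    and N_neg: "\<And>\<omega> t. \<omega> \<in> space M \<Longrightarrow> t < 0 \<Longrightarrow> N t \<omega> = 0"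
    and N_incr: "\<And>s t. s \<le> t \<Longrightarrow> distr M (count_space UNIV) (\<lambda>\<omega>. N t \<omega> - N s \<omega>)
          = measure_pmf (poisson_law (measure \<Lambda> {s<..t}))"
    using assms(1) unfolding nonhomogeneous_poisson_process_def by auto
  interpret prob_space M by (rule prob)
  have space_\<Lambda>: "space \<Lambda> = UNIV" using sets_eq_imp_space_eq[OF sets_\<Lambda>] by simp
  have r: "emeasure \<Lambda> {0..1} = ennreal r" "r > 0"
    using assms(2,3) by (simp_all add: r_def emeasure_eq_ennreal_measure zero_less_measure_iff)

  have N1: "distr M (count_space UNIV) (N 1) = measure_pmf (poisson_pmf r)"
  proof -
    \<comment> \<open>\<open>N\<close> vanishes at negative times, so \<open>N 1\<close> is the increment over
      \<open>(-1, 1]\<close>. Starting at a negative time keeps a possible atom of \<open>\<Lambda>\<close> at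
      0.\<close>
    have "measure \<Lambda> {-1<..1} = r"
    proof -
      have "emeasure \<Lambda> {-1<..<0} \<le> emeasure \<Lambda> {..<0}"
        by (rule emeasure_mono) (auto simp: sets_\<Lambda>)
      then have "{-1<..<0} \<in> null_sets \<Lambda>" using neg by (auto simp: sets_\<Lambda>)
      then have "emeasure \<Lambda> ({0..1} \<union> {-1<..<0}) = emeasure \<Lambda> {0..1}"
        by (intro emeasure_Un_null_set) (auto simp: sets_\<Lambda>)
      moreover have "{0..1} \<union> {-1<..<0} = {-1<..(1::real)}" by auto
      ultimately show ?thesis by (simp add: r_def measure_def)
    qed
    moreover have "distr M (count_space UNIV) (N 1) = distr M (count_space UNIV) (\<lambda>\<omega>. N 1 \<omega> - N (-1) \<omega>)"
      using N_neg by (intro distr_cong) auto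
    ultimately show ?thesis
      using N_incr[of "-1" 1] r(2) by (simp add: poisson_law_def)
  qed

  \<comment> \<open>Truncating the argument at 0 changes nothing for \<open>v\<close> in \<open>[0,1]\<close>,
    and makes the functions continuous on the whole line, although nothing is known about \<open>\<mu>\<close>
    on the negative numbers.\<close>
  define a where "a v = \<mu> (max 0 (t - v))" for v
  define b where "b v = \<mu> (max 0 (t + s - v))" for v
  have a_eq: "\<mu> (t - v) = a v" and b_eq: "\<mu> (t + s - v) = b v" if "v \<in> {0..1}" for v
    using that assms(13,14) by (auto simp: a_def b_def max_def)
  have "continuous_on UNIV a" "continuous_on UNIV b"
    unfolding a_def b_def
    by (rule continuous_on_compose2[OF assms(6)]; auto intro!: continuous_intros)+
  then have a_meas [measurable]: "a \<in> borel_measurable borel" and b_meas [measurable]: "b \<in> borel_measurable borel"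
    by (auto intro: borel_measurable_continuous_onI)
  obtain C where "(\<mu> \<longlongrightarrow> C) at_top" using assms(8) by auto
  then have \<mu>_bound: "0 \<le> \<mu> x \<and> \<mu> x \<le> C" if "x \<ge> 0" for x
    using mono_on_tendsto_at_top_le[OF assms(5), of C x] assms(4) that by auto
  have a_bound: "0 \<le> a v" "a v \<le> C" and b_bound: "0 \<le> b v" "b v \<le> C" for v
    using \<mu>_bound by (auto simp: a_def b_def)

  \<comment> \<open>With \<open>\<Lambda>\<close> restricted to \<open>[0,1]\<close> the measure is finite,
    and set integrals become plain integrals.\<close>
  define K where "K = restrict_space \<Lambda> {0..1}"
  have space_K: "space K = {0..1}" by (simp add: K_def space_restrict_space space_\<Lambda>)
  have int_K: "(\<integral>v. f v \<partial>K) = (LINT v:{0..1}|\<Lambda>. f v)" for f :: "real \<Rightarrow> real"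
    unfolding K_def set_lebesgue_integral_def
    by (rule integral_restrict_space) (simp add: sets_\<Lambda>)
  interpret K: exponential_mixture K a b C r
  proof (intro exponential_mixture.intro exponential_mixture_axioms.intro finite_measureI)
    show "emeasure K (space K) \<noteq> \<infinity>"
      using assms(3) unfolding space_K by (simp add: K_def emeasure_restrict_space sets_\<Lambda> r)
    show "a \<in> borel_measurable K" "b \<in> borel_measurable K"
      unfolding K_def
      by (auto intro!: measurable_restrict_space1 simp: measurable_cong_sets[OF sets_\<Lambda> refl])
  qed (use a_bound b_bound in auto)

  have \<psi>: "\<psi> j = K.Psi j" for j
    unfolding assms(17) psi_def K.Psi_def int_K
    by (intro ext set_lebesgue_integral_cong) (auto simp: sets_\<Lambda> a_eq b_eq)

  have \<phi>: "\<phi> = K.Phi"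
  proof (intro ext)
    fix y z :: real
    define g where "g v = exp (- a v * y - b v * z)" for v
    have [measurable]: "g \<in> borel_measurable borel" unfolding g_def[abs_def] by simp
    have V_meas: "random_variable borel (V j)" if "j \<ge> 1" for j
      using assms(10) that by (auto simp: indep_vars_def)
    have g_bound: "\<bar>g v\<bar> \<le> exp (C * \<bar>y\<bar> + C * \<bar>z\<bar>)" for v
    proof -
      have "- a v * y \<le> \<bar>a v\<bar> * \<bar>y\<bar>" "- b v * z \<le> \<bar>b v\<bar> * \<bar>z\<bar>"
        by (metis abs_ge_self abs_minus_cancel abs_mult)+
      moreover have "\<bar>a v\<bar> * \<bar>y\<bar> \<le> C * \<bar>y\<bar>" "\<bar>b v\<bar> * \<bar>z\<bar> \<le> C * \<bar>z\<bar>"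
        using a_bound[of v] b_bound[of v] by (auto intro!: mult_right_mono)
      ultimately show ?thesis by (simp add: g_def)
    qed
    \<comment> \<open>The marks have law \<open>K / r\<close>, and \<open>m\<close> is the mean of one factor.
      So \<open>r * m\<close> in the exponent of the generating function is the integral of \<open>g\<close>
      over \<open>K\<close>.\<close>
    define m where "m = (\<integral>v. g v \<partial>K) / r"
    have "\<phi> y z = expectation (\<lambda>\<omega>. \<Prod>j=1..N 1 \<omega>. g (V j \<omega>))"
      unfolding assms(16) laplace_transform2_def
    proof (intro Bochner_Integration.integral_cong refl)
      fix \<omega> assume \<omega>: "\<omega> \<in> space M"
      have "V j \<omega> \<in> {0..1}" if "j \<ge> 1" for j using assms(9)[OF that] \<omega> by auto
      then have "random_sum N V \<mu> t \<omega> = (\<Sum>j=1..N 1 \<omega>. a (V j \<omega>))"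
        "random_sum N V \<mu> (t + s) \<omega> = (\<Sum>j=1..N 1 \<omega>. b (V j \<omega>))"
        unfolding random_sum_def by (auto intro!: sum.cong a_eq b_eq)
      then show "exp (- y * random_sum N V \<mu> t \<omega> - z * random_sum N V \<mu> (t + s) \<omega>) =
          (\<Prod>j=1..N 1 \<omega>. g (V j \<omega>))"
        unfolding g_def by (simp add: sum_distrib_left sum_negf sum_subtractf mult.commute flip: exp_sum)
    qed
    also have "\<dots> = exp (r * m - r)"
    proof (rule expectation_prod_upto_poisson[OF N1 r(2) N_meas])
      show "indep_vars (\<lambda>_. borel) (\<lambda>j \<omega>. g (V j \<omega>)) {1..}"
        by (rule indep_vars_compose2[OF assms(10)]) simp
      show "integrable M (\<lambda>\<omega>. g (V j \<omega>))" if "j \<ge> 1" for j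
        using V_meas[OF that] g_bound
        by (intro integrable_const_bound[where B = "exp (C * \<bar>y\<bar> + C * \<bar>z\<bar>)"]) auto
      show "expectation (\<lambda>\<omega>. g (V j \<omega>)) = m" if "j \<ge> 1" for j
      proof -
        have "expectation (\<lambda>\<omega>. g (V j \<omega>)) = (\<integral>v. g v \<partial>distr M borel (V j))"
          using V_meas[OF that] by (subst integral_distr) auto
        also have "\<dots> = m"
          unfolding assms(11)[OF that] m_def int_K r_def
          using r by (intro integral_uniform_measure) (auto simp: sets_\<Lambda> measurable_cong_sets[OF sets_\<Lambda> refl])
        finally show ?thesis .
      qed
      show "indep_set (sigma_sets (space M) {N 1 -` A \<inter> space M | A. True})
        (sigma_sets (space M) {(\<lambda>\<omega>. g (V j \<omega>)) -` B \<inter> space M | j B. j \<ge> 1 \<and> B \<in> sets borel})"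
      proof (rule indep_set_mono[OF assms(12)[unfolded indep_process_sequence_def]])
        show "sigma_sets (space M) {N 1 -` A \<inter> space M | A. True}
            \<subseteq> sigma_sets (space M) {N t -` A \<inter> space M | t A. t \<ge> 0}"
          by (rule sigma_sets_mono') (auto intro!: exI[of _ "1::real"])
        show "sigma_sets (space M) {(\<lambda>\<omega>. g (V j \<omega>)) -` B \<inter> space M | j B. j \<ge> 1 \<and> B \<in> sets borel}
            \<subseteq> sigma_sets (space M) {V j -` B \<inter> space M | j B. j \<ge> 1 \<and> B \<in> sets borel}"
        proof (rule sigma_sets_mono', safe)
          fix j :: nat and B :: "real set" assume "j \<ge> 1" "B \<in> sets borel"
          then show "\<exists>j' B'. (\<lambda>\<omega>. g (V j \<omega>)) -` B \<inter> space M = V j' -` B' \<inter> space M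
              \<and> j' \<ge> 1 \<and> B' \<in> sets borel"
            using measurable_sets[of g borel borel B]
            by (intro exI[of _ j] exI[of _ "g -` B"]) auto
        qed
      qed
    qed (simp add: g_def)
    also have "\<dots> = K.Phi y z"
      using r(2) by (simp add: K.Phi_def m_def g_def)
    finally show "\<phi> y z = K.Phi y z" .
  qed

  have \<psi>_deriv: "(deriv ^^ l) (\<psi> j) 1 =
      (LINT v:{0..1}|\<Lambda>. (- \<mu> (t + s - v)) ^ j * (- \<mu> (t - v)) ^ l * exp (- \<mu> (t - v)))" for j
    unfolding \<psi> K.higher_deriv_Psi int_K
    by (intro set_lebesgue_integral_cong) (auto simp: sets_\<Lambda> a_eq b_eq)
  show ?thesis
    unfolding \<psi>_deriv
    unfolding \<phi> \<psi>
    using K.partial_deriv_exists_Phi smooth_imp_times_differentiable[OF K.smooth_Psi]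
      K.partial_deriv_Phi_0[OF \<open>l \<ge> 1\<close>] K.partial_deriv_Phi_1 K.partial_deriv_Phi_2
    by blast
qed

end
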